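(* Let $\mathcal{C}:\mathcal{P}(\mathbb{R}^n)\to[0,\infty]$ be an outer measure which satisfies the packing assumption (P). For every $f\in L^1(\mathbb{R}^n;\mathcal{C})$ one has $$\lim_{Q'\to x}\frac{1}{\mathcal{C}(Q')}\int_{Q'}|f-f(x)|\,d\mathcal{C}=0$$ for $\mathcal{C}$-quasi every $x\in\mathbb{R}^n$, where the limit is taken over the dyadic tower of cubes $Q'\in\mathcal{D}(Q)$ containing $x$ that shrink to $x$.
   Context: Outer measure: $\mathcal{C}(\emptyset)=0$; $A\subset B$ implies $\mathcal{C}(A)\le\mathcal{C}(B)$; $A\subset\bigcup_{i=1}^\infty A_i$ implies $\mathcal{C}(A)\le\sum_i\mathcal{C}(A_i)$ (all subsets of $\mathbb{R}^n$). Dyadic cubes. Fix a half-open cube $Q=[x_1,x_1+\ell)\times\cdots\times[x_n,x_n+\ell)\subset\mathbb{R}^n$, $\ell>0$, and put $x_Q=(x_1,\dots,x_n)$. Let $\mathcal{D}_0(Q)=\{x_Q+2^k\ell(m+[0,1)^n): k\in\mathbb{Z}, m\in\mathbb{Z}^n\}$ and $\mathcal{D}(Q)=\mathcal{D}_0(Q)\cup\{\prod_{i=1}^n I_i: I_i=[x_i,\infty)\text{ or }(-\infty,x_i)\}$. Choquet integral. $\int_A f\,d\mathcal{C}=\int_0^\infty\mathcal{C}(\{x\in A: f(x)>t\})\,dt$ for $f\ge0$. Convention: $0\cdot\infty=0$, and an average over $Q'$ is $0$ if $\mathcal{C}(Q')=0$. Packing assumption (P): there is a constant $A_0\ge1$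 such that for every non-overlapping collection $\{Q_j\}\subset\mathcal{D}(Q)$ satisfying $\sum_{Q_j\subset Q'}\mathcal{C}(Q_j)\le A_0\,\mathcal{C}(Q')$ for every $Q'\in\mathcal{D}(Q)$, one has $\sum_j\int_{Q_j}f\,d\mathcal{C}\le A_0\int_{\cup_jQ_j}f\,d\mathcal{C}$ for every $f:\mathbb{R}^n\to[0,\infty]$. $L^1(\mathbb{R}^n;\mathcal{C})$ is the set of $\mathcal{C}$-quasicontinuous $f:\mathbb{R}^n\to\mathbb{R}$ with $\int_{\mathbb{R}^n}|f|\,d\mathcal{C}<\infty$; $f$ is $\mathcal{C}$-quasicontinuous if for every $\epsilon>0$ there is an open set $O_\epsilon$ with $\mathcal{C}(O_\epsilon)<\epsilon$ and $f|_{O_\epsilon^c}$ continuous. "For $\mathcal{C}$-quasi every $x$" means: outside some set $E$ with $\mathcal{C}(E)=0$. *)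

theory Defs
  imports "HOL-Analysis.Analysis"
begin

text \<open>
  Outer measures are the library's \<^const>\<open>outer_measure_space\<close> on the full power set. The library
  asks for countable subadditivity on disjoint families only; together with monotonicity
  this is the textbook definition.
\<close>

lemma outer_measure_space_Pow_UNIV_iff:
  fixes C :: "'a set \<Rightarrow> ennreal"
  shows "outer_measure_space (Pow UNIV) C \<longleftrightarrow>
    C {} = 0 \<and> (\<forall>A B. A \<subseteq> B \<longrightarrow> C A \<le> C B) \<and>
    (\<forall>A (S :: nat \<Rightarrow> 'a set). A \<subseteq> (\<Union>i. S i) \<longrightarrow> C A \<le> (\<Sum>i. C (S i)))"
    (is "?L \<longleftrightarrow> ?R")
proof
  assume L: ?L
  have mono: "C A \<le> C B" if "A \<subseteq> B" for A B
    using L that by (simp add: outer_measure_space_def increasing_def)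
  have "C A \<le> (\<Sum>i. C (S i))" if "A \<subseteq> (\<Union>i. S i)" for A and S :: "nat \<Rightarrow> 'a set"
  proof -
    have "C A \<le> C (\<Union>i. disjointed S i)"
      using that by (intro mono) (simp add: UN_disjointed_eq)
    also have "\<dots> \<le> (\<Sum>i. C (disjointed S i))"
      using L disjoint_family_disjointed[of S]
      unfolding outer_measure_space_def countably_subadditive_def by simp
    also have "\<dots> \<le> (\<Sum>i. C (S i))"
      by (intro suminf_le mono disjointed_subset) auto
    finally show ?thesis .
  qed
  moreover have "C {} = 0"
    using L by (simp add: outer_measure_space_def positive_def)
  ultimately show ?R
    using mono by blast
next
  assume R: ?R
  have "positive (Pow UNIV) C" "increasing (Pow UNIV) C"
    using R by (simp_all add: positive_def increasing_def)
  moreover have "countably_subadditive (Pow UNIV) C"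
    unfolding countably_subadditive_def using R by blast
  ultimately show ?L
    by (simp add: outer_measure_space_def)
qed

definition choquet_integral :: "('a set \<Rightarrow> ennreal) \<Rightarrow> 'a set \<Rightarrow> ('a \<Rightarrow> ennreal) \<Rightarrow> ennreal" where
  "choquet_integral C A f = (\<integral>\<^sup>+t\<in>{0..}. C {x \<in> A. f x > ennreal t} \<partial>lborel)"

text \<open>
  In \<^typ>\<open>ennreal\<close>, division by \<open>\<infinity>\<close> is multiplication by \<open>0\<close> and \<open>\<infinity> * 0 = 0\<close>, so the average
  is \<open>0\<close> also when \<open>C A = \<infinity>\<close>.
\<close>

definition choquet_average :: "('a set \<Rightarrow> ennreal) \<Rightarrow> 'a set \<Rightarrow> ('a \<Rightarrow> ennreal) \<Rightarrow> ennreal" where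
  "choquet_average C A f = (if C A = 0 then 0 else choquet_integral C A f / C A)"

definition half_open_cube :: "real ^ 'n \<Rightarrow> real \<Rightarrow> (real ^ 'n) set" where
  "half_open_cube c s = {y. \<forall>i. c $ i \<le> y $ i \<and> y $ i < c $ i + s}"

text \<open>
  The initial cube \<open>Q\<close> is \<open>half_open_cube a l\<close> with \<open>l > 0\<close>, so that \<open>x\<^sub>Q = a\<close>; the
  dyadic systems are parametrised by \<open>a\<close> and \<open>l\<close>.
\<close>

definition dyadic_cubes0 :: "real ^ 'n \<Rightarrow> real \<Rightarrow> (real ^ 'n) set set" where
  "dyadic_cubes0 a l =
    {half_open_cube (a + (2 powi k * l) *\<^sub>R (\<chi> i. real_of_int (m i))) (2 powi k * l)
      | (k :: int) (m :: 'n \<Rightarrow> int). True}"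

definition dyadic_orthants :: "real ^ 'n \<Rightarrow> (real ^ 'n) set set" where
  "dyadic_orthants a =
    {{y. \<forall>i. y $ i \<in> I i} | I. \<forall>i. I i = {a $ i..} \<or> I i = {..<a $ i}}"

definition dyadic_cubes :: "real ^ 'n \<Rightarrow> real \<Rightarrow> (real ^ 'n) set set" where
  "dyadic_cubes a l = dyadic_cubes0 a l \<union> dyadic_orthants a"

text \<open>
  Members of \<^const>\<open>dyadic_cubes\<close> are half-open, so a non-overlapping collection is
  a pairwise disjoint one. Sums of \<^typ>\<open>ennreal\<close>-valued families always exist.
\<close>

definition packing_assumption :: "((real ^ 'n) set \<Rightarrow> ennreal) \<Rightarrow> real ^ 'n \<Rightarrow> real \<Rightarrow> bool" where
  "packing_assumption C a l \<longleftrightarrow>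
    (\<exists>A0 :: real. A0 \<ge> 1 \<and>
      (\<forall>F. F \<subseteq> dyadic_cubes a l \<and> disjoint F \<and>
           (\<forall>Q' \<in> dyadic_cubes a l. (\<Sum>\<^sub>\<infinity>R\<in>{R \<in> F. R \<subseteq> Q'}. C R) \<le> ennreal A0 * C Q')
         \<longrightarrow> (\<forall>f :: real ^ 'n \<Rightarrow> ennreal.
               (\<Sum>\<^sub>\<infinity>R\<in>F. choquet_integral C R f) \<le> ennreal A0 * choquet_integral C (\<Union>F) f)))"

definition quasicontinuous :: "('a::topological_space set \<Rightarrow> ennreal) \<Rightarrow> ('a \<Rightarrow> real) \<Rightarrow> bool" where
  "quasicontinuous C f \<longleftrightarrow>
    (\<forall>\<epsilon>::real. \<epsilon> > 0 \<longrightarrow> (\<exists>U. open U \<and> C U < ennreal \<epsilon> \<and> continuous_on (- U) f))"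

definition choquet_L1 :: "('a::topological_space set \<Rightarrow> ennreal) \<Rightarrow> ('a \<Rightarrow> real) set" where
  "choquet_L1 C =
    {f. quasicontinuous C f \<and> choquet_integral C UNIV (\<lambda>x. ennreal \<bar>f x\<bar>) < \<infinity>}"

text \<open>
  The filter of cubes \<open>Q' \<rightarrow> x\<close>. Requiring \<open>Q' \<subseteq> ball x r\<close> rather than a bound on
  the diameter excludes the orthants, on which \<^const>\<open>diameter\<close> is unspecified.
\<close>

definition dyadic_tower :: "real ^ 'n \<Rightarrow> real \<Rightarrow> real ^ 'n \<Rightarrow> (real ^ 'n) set filter" where
  "dyadic_tower a l x = (INF r\<in>{0<..}. principal {Q' \<in> dyadic_cubes a l. x \<in> Q' \<and> Q' \<subseteq> ball x r})"

lemma eventually_dyadic_tower: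
  "eventually P (dyadic_tower a l x) \<longleftrightarrow>
    (\<exists>r>0. \<forall>Q' \<in> dyadic_cubes a l. x \<in> Q' \<and> Q' \<subseteq> ball x r \<longrightarrow> P Q')"
proof -
  have "\<exists>r\<in>{0<..}. principal {Q' \<in> dyadic_cubes a l. x \<in> Q' \<and> Q' \<subseteq> ball x r}
      \<le> inf (principal {Q' \<in> dyadic_cubes a l. x \<in> Q' \<and> Q' \<subseteq> ball x s})
            (principal {Q' \<in> dyadic_cubes a l. x \<in> Q' \<and> Q' \<subseteq> ball x t})"
    if "s \<in> {0<..}" "t \<in> {0<..}" for s t :: real
    using that by (intro bexI[of _ "min s t"]) auto
  then show ?thesis
    unfolding dyadic_tower_def
    by (subst eventually_INF_base) (auto simp: eventually_principal Bex_def simp del: ball_simps)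
qed

end

theory Submission
  imports Defs
begin

text \<open>
  Off an open set \<open>U\<close> of small capacity \<open>f\<close> is continuous. For \<open>x \<notin> U\<close> with \<open>\<bar>f x\<bar> \<le> N\<close> the
  deviation \<open>\<bar>f y - f x\<bar>\<close> is small at points \<open>y \<notin> U\<close> near \<open>x\<close>, and it is at most
  \<open>g y = 2 * max N \<bar>f y\<bar>\<close> on \<open>U\<close>. Hence the average deviation can stay large only on \<open>U\<close> and where the
  dyadic maximal function of \<open>g\<close>, cut off to \<open>U\<close>, is large. The Choquet integral of the cut-off tends
  to \<open>0\<close> with \<open>C U\<close>, so a weak type estimate for the maximal function finishes the proof.

  The weak type estimate is proved inside one fixed cube \<open>Q0\<close>, which makes maximal cubes exist.
  The packing assumption does not apply to the stopping cubes themselves; it is applied to a subfamily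
  satisfying the packing condition with constant \<open>1\<close>, chosen so that the stopping cubes lie in dyadic
  cubes whose capacity is controlled by the total capacity of the selected cubes inside them.
\<close>

section \<open>Outer measures and packed families\<close>

lemma summable_ennreal: "(f :: 'a \<Rightarrow> ennreal) summable_on A"
  by (simp add: nonneg_summable_on_complete)

lemma sum_le_infsum_ennreal:
  fixes f :: "'a \<Rightarrow> ennreal"
  assumes "finite S" "S \<subseteq> A"
  shows "sum f S \<le> infsum f A"
  using assms by (simp add: nonneg_infsum_complete SUP_upper)

lemma infsum_le_iff_finite_sums_ennreal:
  fixes f :: "'a \<Rightarrow> ennreal"
  shows "infsum f A \<le> b \<longleftrightarrow> (\<forall>S. finite S \<and> S \<subseteq> A \<longrightarrow> sum f S \<le> b)"
  by (auto simp: nonneg_infsum_complete SUP_le_iff)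

lemma infsum_subset_mono_ennreal:
  fixes f :: "'a \<Rightarrow> ennreal"
  assumes "A \<subseteq> B"
  shows "infsum f A \<le> infsum f B"
  unfolding infsum_le_iff_finite_sums_ennreal
  using assms by (metis subset_trans sum_le_infsum_ennreal)

lemma sum_infsum_disjoint_le_ennreal:
  fixes f :: "'a \<Rightarrow> ennreal"
  assumes "finite S" "disjoint_family_on A S" "\<And>i. i \<in> S \<Longrightarrow> A i \<subseteq> B"
  shows "(\<Sum>i\<in>S. infsum f (A i)) \<le> infsum f B"
proof -
  have "(\<Sum>i\<in>S. infsum f (A i)) = infsum f (\<Union>i\<in>S. A i)"
    using assms(1,2)
  proof (induction S rule: finite_induct)
    case (insert i S)
    then have "A i \<inter> (\<Union>j\<in>S. A j) = {}"
      by (auto simp: disjoint_family_on_def)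
    moreover have "disjoint_family_on A S"
      using insert.prems by (auto simp: disjoint_family_on_def)
    ultimately show ?case
      using insert infsum_Un_disjoint[OF summable_ennreal summable_ennreal, of "A i" "\<Union>j\<in>S. A j" f]
      by simp
  qed simp
  also have "\<dots> \<le> infsum f B"
    using assms(3) by (intro infsum_subset_mono_ennreal) auto
  finally show ?thesis .
qed

text \<open>Superlevel sets of a decreasing function are intervals. This makes the integrand of the
  Choquet integral measurable for arbitrary functions and sets.\<close>

lemma antimono_borel_measurable_ennreal:
  fixes F :: "real \<Rightarrow> ennreal"
  assumes "antimono F"
  shows "F \<in> borel_measurable borel"
proof (rule borel_measurableI_greater)
  fix y
  have "is_interval {x. y < F x}"
    unfolding is_interval_1 using assms by (auto simp: monotone_def intro: less_le_trans)
  then show "{x \<in> space borel. y < F x} \<in> sets borel"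
    by (simp add: real_interval_borel_measurable)
qed

locale outer_capacity =
  fixes C :: "'a set \<Rightarrow> ennreal"
  assumes outer: "outer_measure_space (Pow UNIV) C"
begin

lemma empty [simp]: "C {} = 0"
  and mono: "A \<subseteq> B \<Longrightarrow> C A \<le> C B"
  and countably_subadd: "A \<subseteq> (\<Union>i::nat. S i) \<Longrightarrow> C A \<le> (\<Sum>i. C (S i))"
proof -
  note R = outer[unfolded outer_measure_space_Pow_UNIV_iff]
  show "C {} = 0" "A \<subseteq> B \<Longrightarrow> C A \<le> C B" "A \<subseteq> (\<Union>i::nat. S i) \<Longrightarrow> C A \<le> (\<Sum>i. C (S i))"
    using conjunct1[OF R] conjunct1[OF conjunct2[OF R]] conjunct2[OF conjunct2[OF R]] by simp_all
qed

lemma subadd: "C (A \<union> B) \<le> C A + C B"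
proof -
  have "C (A \<union> B) \<le> (\<Sum>i. C (binaryset A B i))"
    by (rule countably_subadd) (simp add: UN_binaryset_eq)
  also have "\<dots> = C A + C B"
    by (intro suminf_binaryset_eq) simp
  finally show ?thesis .
qed

text \<open>The later estimates arrive as bounds on finite partial sums. The index set is enumerated
  by \<open>to_nat_on\<close>, and the naturals that it misses receive the empty set, of capacity
  0.\<close>

lemma countable_Union_le:
  assumes "countable I" "\<And>S. finite S \<Longrightarrow> S \<subseteq> I \<Longrightarrow> (\<Sum>i\<in>S. C (A i)) \<le> B"
  shows "C (\<Union>i\<in>I. A i) \<le> B"
proof -
  define N where "N = to_nat_on I ` I"
  define A' where "A' n = (if n \<in> N then A (from_nat_into I n) else {})" for n
  have inj: "inj_on (from_nat_into I) N"
    unfolding N_def using assms(1) by (auto intro!: inj_onI)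
  have "A i \<subseteq> A' (to_nat_on I i)" if "i \<in> I" for i
    using that assms(1) by (simp add: A'_def N_def)
  then have "C (\<Union>i\<in>I. A i) \<le> (\<Sum>n. C (A' n))"
    by (intro countably_subadd) blast
  also have "\<dots> = (SUP k. \<Sum>n<k. C (A' n))"
    by (rule suminf_eq_SUP)
  also have "\<dots> \<le> B"
  proof (rule SUP_least)
    fix k
    have "(\<Sum>n<k. C (A' n)) = (\<Sum>n\<in>{..<k} \<inter> N. C (A (from_nat_into I n)))"
      by (subst sum.inter_restrict) (auto simp: A'_def intro!: sum.cong)
    also have "\<dots> = (\<Sum>i\<in>from_nat_into I ` ({..<k} \<inter> N). C (A i))"
      using inj by (subst sum.reindex) (auto intro: inj_on_subset)
    also have "\<dots> \<le> B"
      using assms(1) by (intro assms(2)) (auto simp: N_def)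
    finally show "(\<Sum>n<k. C (A' n)) \<le> B" .
  qed
  finally show ?thesis .
qed

lemma null_UN:
  assumes "countable I" "\<And>i. i \<in> I \<Longrightarrow> C (A i) = 0"
  shows "C (\<Union>i\<in>I. A i) = 0"
proof -
  have "C (\<Union>i\<in>I. A i) \<le> 0"
    using assms(2) by (intro countable_Union_le[OF assms(1)]) (auto simp: subset_iff)
  then show ?thesis by simp
qed

text \<open>The packing condition of (P) with constant 1 and with test sets restricted to
  \<open>D\<close>. In the application \<open>D\<close> consists of the dyadic subcubes of one
  cube.\<close>

definition packed :: "'a set set \<Rightarrow> 'a set set \<Rightarrow> bool" where
  "packed D G \<longleftrightarrow> (\<forall>Q\<in>D. infsum C {R \<in> G. R \<subseteq> Q} \<le> C Q)"

text \<open>Being packed is of finite character: an infinite sum is the supremum of its finite sums,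
  and finitely many members of the union of a chain already lie in one element of the chain.\<close>

lemma packed_Union_chain:
  assumes "subset.chain UNIV \<C>" "\<C> \<noteq> {}" "\<And>G. G \<in> \<C> \<Longrightarrow> packed D G"
  shows "packed D (\<Union>\<C>)"
  unfolding packed_def infsum_le_iff_finite_sums_ennreal
proof (intro ballI allI impI)
  fix Q S assume Q: "Q \<in> D" and S: "finite S \<and> S \<subseteq> {R \<in> \<Union>\<C>. R \<subseteq> Q}"
  then have fin: "finite S" and sub: "S \<subseteq> \<Union>\<C>" by auto
  obtain G where G: "G \<in> \<C>" "S \<subseteq> G"
    using finite_subset_Union_chain[OF fin sub assms(2,1)] by blast
  have "sum C S \<le> infsum C {R \<in> G. R \<subseteq> Q}"
    using S G by (intro sum_le_infsum_ennreal) auto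
  also have "\<dots> \<le> C Q"
    using assms(3)[OF G(1)] Q by (simp add: packed_def)
  finally show "sum C S \<le> C Q" .
qed

text \<open>Zorn's lemma. Maximality is stated so that every rejected set comes with a violated
  packing inequality.\<close>

lemma packed_maximal_extension:
  assumes "packed D G0" "G0 \<subseteq> F"
  obtains G where "packed D G" "G0 \<subseteq> G" "G \<subseteq> F"
    "\<And>Q. Q \<in> F \<Longrightarrow> packed D (insert Q G) \<Longrightarrow> Q \<in> G"
proof -
  let ?P = "{G. packed D G \<and> G0 \<subseteq> G \<and> G \<subseteq> F}"
  have "\<exists>G\<in>?P. \<forall>X\<in>?P. G \<subseteq> X \<longrightarrow> X = G"
  proof (rule subset_Zorn_nonempty)
    show "?P \<noteq> {}" using assms by auto
    fix \<C> assume "\<C> \<noteq> {}" and ch: "subset.chain ?P \<C>"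
    have "packed D (\<Union>\<C>)"
      using ch \<open>\<C> \<noteq> {}\<close> by (intro packed_Union_chain) (auto simp: subset_chain_def)
    then show "\<Union>\<C> \<in> ?P"
      using ch \<open>\<C> \<noteq> {}\<close> by (auto simp: subset.chain_def)
  qed
  then obtain G where "G \<in> ?P" and max: "\<forall>X\<in>?P. G \<subseteq> X \<longrightarrow> X = G" by blast
  show thesis
  proof (rule that)
    fix Q assume "Q \<in> F" "packed D (insert Q G)"
    then have "insert Q G \<in> ?P" using \<open>G \<in> ?P\<close> by auto
    then have "insert Q G = G" by (rule max[rule_format]) (rule subset_insertI)
    then show "Q \<in> G" by (metis insertI1)
  qed (use \<open>G \<in> ?P\<close> in simp_all)
qed

text \<open>
  The family is thinned out greedily, one scale \<open>H / 2 ^ k\<close> of capacities after the other.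
  If \<open>Q\<close> is rejected because of \<open>Q'\<close>, then \<open>Q'\<close> contains a selected set of capacity at
  least \<open>C Q / 2\<close>, hence \<open>C Q' \<le> S + C Q \<le> 3 * S\<close> where \<open>S\<close> is the selected mass in \<open>Q'\<close>.
\<close>

lemma packed_selection:
  assumes F: "F \<subseteq> D" and H: "\<And>Q. Q \<in> F \<Longrightarrow> C Q \<le> H" "H < \<infinity>"
    and pos: "\<And>Q. Q \<in> F \<Longrightarrow> 0 < C Q"
  obtains G where "G \<subseteq> F" "packed D G"
    "\<And>Q. Q \<in> F \<Longrightarrow> \<exists>Q'\<in>D. Q \<subseteq> Q' \<and> C Q' \<le> 3 * infsum C {R \<in> G. R \<subseteq> Q'}"
proof -
  \<comment> \<open>Sets of capacity above \<open>H / 2 ^ k\<close>, multiplied out. By the bound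
    \<open>H\<close> the level \<open>L 0\<close> is empty.\<close>
  define L where "L k = {Q \<in> F. H < 2 ^ k * C Q}" for k :: nat
  have L_mono: "L k \<subseteq> L (Suc k)" for k
  proof -
    have "2 ^ k * c \<le> 2 ^ Suc k * c" for c :: ennreal
      by (intro mult_right_mono power_increasing) auto
    then show ?thesis
      unfolding L_def by (auto intro: less_le_trans)
  qed
  \<comment> \<open>Stage \<open>k\<close> is saturated within \<open>L k\<close>, so that large
    sets are decided before smaller ones are considered.\<close>
  define P where "P k G \<longleftrightarrow> packed D G \<and> G \<subseteq> L k \<and>
    (\<forall>Q\<in>L k. packed D (insert Q G) \<longrightarrow> Q \<in> G)" for k G
  have ex0: "\<exists>G. P 0 G"
    using packed_maximal_extension[of D "{}" "L 0"] by (metis (no_types, lifting) P_def packed_def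
      empty_subsetI empty_iff infsum_empty Collect_empty_eq zero_le)
  have exS: "\<exists>G'. P (Suc k) G' \<and> G \<subseteq> G'" if "P k G" for k G
    using packed_maximal_extension[of D G "L (Suc k)"] that L_mono unfolding P_def
    by (metis subset_trans)
  obtain g where g: "\<And>k. P k (g k)" "\<And>k. g k \<subseteq> g (Suc k)"
    using dependent_nat_choice[of P "\<lambda>k G G'. G \<subseteq> G'", OF ex0 exS] by auto
  have g_mono: "g i \<subseteq> g j" if "i \<le> j" for i j
    using g(2) that by (rule lift_Suc_mono_le)
  define G where "G = (\<Union>k. g k)"
  have GF: "G \<subseteq> F" using g(1) by (auto simp: G_def P_def L_def)
  have chain: "subset.chain UNIV (range g)"
    unfolding subset_chain_def using g_mono by (metis UNIV_I imageE nle_le subset_UNIV)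
  have packed_G: "packed D G"
    unfolding G_def using g(1) by (intro packed_Union_chain[OF chain]) (auto simp: P_def)
  have "\<exists>Q'\<in>D. Q \<subseteq> Q' \<and> C Q' \<le> 3 * infsum C {R \<in> G. R \<subseteq> Q'}" if Q: "Q \<in> F" for Q
  proof (cases "Q \<in> G")
    case True
    then have "C Q \<le> infsum C {R \<in> G. R \<subseteq> Q}"
      using sum_le_infsum_ennreal[of "{Q}" "{R \<in> G. R \<subseteq> Q}" C] by simp
    also have "\<dots> \<le> 3 * infsum C {R \<in> G. R \<subseteq> Q}"
      using mult_right_mono[of 1 3 "infsum C {R \<in> G. R \<subseteq> Q}"] by simp
    finally show ?thesis using F Q by blast
  next
    case False
    have fin: "C Q < \<infinity>" using H Q by (metis le_less_trans)
    have "\<exists>k. Q \<in> L k"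
    proof -
      obtain n where n: "H / C Q < of_nat n"
        using pos[OF Q] H(2) ennreal_Ex_less_of_nat[of "H / C Q"]
        by (metis ennreal_divide_eq_top_iff infinity_ennreal_def less_irrefl less_top)
      have "of_nat n \<le> (2 ^ n :: ennreal)"
        by (metis of_nat_mono of_nat_power of_nat_numeral less_exp less_imp_le)
      then have "H / C Q < 2 ^ n" using n by (rule less_le_trans[rotated])
      then have "H < 2 ^ n * C Q"
        using pos[OF Q] fin by (simp add: divide_less_ennreal)
      then show ?thesis using Q by (auto simp: L_def)
    qed
    \<comment> \<open>At the first level containing \<open>Q\<close>, its capacity is at most twice
      the threshold, while every set selected so far exceeds the threshold. Hence
      \<open>C Q \<le> 2 * C R\<close> for each \<open>R\<close> in \<open>g k\<close>.\<close>
    define k where "k = (LEAST k. Q \<in> L k)"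
    have k: "Q \<in> L k" unfolding k_def using \<open>\<exists>k. Q \<in> L k\<close> by (rule LeastI_ex)
    have prev: "Q \<notin> L j" if "j < k" for j using that unfolding k_def by (rule not_less_Least)
    have "Q \<notin> g k" using False by (auto simp: G_def)
    then have "\<not> packed D (insert Q (g k))" using g(1)[of k] k by (auto simp: P_def)
    then obtain Q' where Q': "Q' \<in> D" "\<not> infsum C {R \<in> insert Q (g k). R \<subseteq> Q'} \<le> C Q'"
      by (auto simp: packed_def)
    let ?S = "infsum C {R \<in> g k. R \<subseteq> Q'}"
    have S_le: "?S \<le> C Q'" using g(1)[of k] Q' by (auto simp: P_def packed_def)
    have "Q \<subseteq> Q'"
    proof (rule ccontr)
      assume "\<not> Q \<subseteq> Q'"
      then have "{R \<in> insert Q (g k). R \<subseteq> Q'} = {R \<in> g k. R \<subseteq> Q'}" by auto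
      then show False using Q' S_le by simp
    qed
    have ins: "{R \<in> insert Q (g k). R \<subseteq> Q'} = {Q} \<union> {R \<in> g k. R \<subseteq> Q'}"
      using \<open>Q \<subseteq> Q'\<close> by auto
    have "infsum C {R \<in> insert Q (g k). R \<subseteq> Q'} = C Q + ?S"
      unfolding ins using \<open>Q \<notin> g k\<close>
      by (subst infsum_Un_disjoint[OF summable_ennreal summable_ennreal]) auto
    then have less: "C Q' < C Q + ?S" using Q' by simp
    \<comment> \<open>With nothing selected inside \<open>Q'\<close>, the violation would read
      \<open>C Q' < C Q\<close>, against monotonicity.\<close>
    have "{R \<in> g k. R \<subseteq> Q'} \<noteq> {}"
    proof
      assume "{R \<in> g k. R \<subseteq> Q'} = {}"
      then have "C Q' < C Q" using less by (simp del: Collect_empty_eq)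
      then show False using mono[OF \<open>Q \<subseteq> Q'\<close>] by simp
    qed
    then obtain R where R: "R \<in> g k" "R \<subseteq> Q'" by blast
    have "R \<in> L k" using R g(1)[of k] by (auto simp: P_def)
    have "C Q \<le> 2 * C R"
    proof (cases k)
      case 0
      then have "C Q \<le> H" "H < C R" using H Q \<open>R \<in> L k\<close> by (auto simp: L_def)
      then have "C Q \<le> C R" by simp
      also have "\<dots> \<le> 2 * C R" using mult_right_mono[of 1 2 "C R"] by simp
      finally show ?thesis .
    next
      case (Suc j)
      then have "2 ^ j * C Q \<le> H" using prev[of j] Q by (auto simp: L_def not_less)
      also have "H \<le> 2 ^ j * (2 * C R)"
        using \<open>R \<in> L k\<close> Suc by (auto simp: L_def ac_simps less_imp_le)
      finally show ?thesis
        by (subst (asm) ennreal_mult_le_mult_iff) (auto simp: power_eq_top_ennreal)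
    qed
    also have "C R \<le> ?S"
      using sum_le_infsum_ennreal[of "{R}" "{R \<in> g k. R \<subseteq> Q'}" C] R by simp
    finally have "C Q \<le> 2 * ?S" by (simp add: mult_left_mono)
    then have "C Q' \<le> 2 * ?S + ?S" using less by (meson add_right_mono less_imp_le order_trans)
    also have "\<dots> = 3 * ?S" using distrib_right[of 2 1 ?S] by simp
    also have "\<dots> \<le> 3 * infsum C {R \<in> G. R \<subseteq> Q'}"
      by (intro mult_left_mono infsum_subset_mono_ennreal) (auto simp: G_def)
    finally show ?thesis using Q' \<open>Q \<subseteq> Q'\<close> by blast
  qed
  then show thesis using that[OF GF packed_G] by blast
qed

end

section \<open>Dyadic cubes\<close>

text \<open>Dyadic cubes of level \<open>k\<close> are the fibres of this map, so nesting becomes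
  integer arithmetic. Larger \<open>k\<close> means coarser cubes.\<close>

definition dyadic_index :: "real ^ 'n \<Rightarrow> real \<Rightarrow> int \<Rightarrow> real ^ 'n \<Rightarrow> 'n \<Rightarrow> int" where
  "dyadic_index a l k y i = \<lfloor>(y $ i - a $ i) / (2 powi k * l)\<rfloor>"

lemma mem_dyadic_cube_iff:
  assumes "l > 0"
  shows "y \<in> half_open_cube (a + (2 powi k * l) *\<^sub>R (\<chi> i. real_of_int (m i))) (2 powi k * l)
    \<longleftrightarrow> dyadic_index a l k y = m"
proof -
  have pos: "2 powi k * l > 0" using assms by simp
  have "(a + (2 powi k * l) *\<^sub>R (\<chi> i. real_of_int (m i))) $ i \<le> y $ i \<and>
      y $ i < (a + (2 powi k * l) *\<^sub>R (\<chi> i. real_of_int (m i))) $ i + 2 powi k * l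
    \<longleftrightarrow> dyadic_index a l k y i = m i" for i
    unfolding dyadic_index_def floor_eq_iff using pos by (simp add: field_simps)
  then show ?thesis
    unfolding half_open_cube_def by (auto simp: fun_eq_iff)
qed

lemma dyadic_cubes0_eq:
  assumes "l > 0"
  shows "dyadic_cubes0 a l = {{y. dyadic_index a l k y = m} | k m. True}"
proof -
  have "half_open_cube (a + (2 powi k * l) *\<^sub>R (\<chi> i. real_of_int (m i))) (2 powi k * l)
      = {y. dyadic_index a l k y = m}" for k m
    using mem_dyadic_cube_iff[OF assms] by blast
  then show ?thesis unfolding dyadic_cubes0_def by auto
qed

lemma countable_dyadic_cubes0: "countable (dyadic_cubes0 a l)"
proof -
  have "dyadic_cubes0 a l = (\<lambda>(k, m). half_open_cube
    (a + (2 powi k * l) *\<^sub>R (\<chi> i. real_of_int (m i))) (2 powi k * l)) ` UNIV"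
    unfolding dyadic_cubes0_def by auto
  then show ?thesis by simp
qed

text \<open>Taking the floor and then dividing by a positive integer with rounding down gives the
  same as a single floor.\<close>

lemma dyadic_index_coarser:
  assumes "l > 0" "k \<le> k'"
  shows "dyadic_index a l k' y i = dyadic_index a l k y i div 2 ^ nat (k' - k)"
proof -
  have "2 powi k' = 2 powi k * (2 ^ nat (k' - k) :: real)"
    using assms(2) power_int_add[of "2::real" k "k' - k"] by (simp add: power_int_def[of _ "k' - k"])
  then have "(y $ i - a $ i) / (2 powi k' * l)
      = (y $ i - a $ i) / (2 powi k * l) / real_of_int (2 ^ nat (k' - k))"
    by simp
  then show ?thesis
    unfolding dyadic_index_def by (simp only: floor_divide_real_eq_div zero_le_power zero_le_numeral)
qed

lemma dyadic_index_eq_coarser: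
  assumes "l > 0" "k \<le> k'" "dyadic_index a l k y = dyadic_index a l k z"
  shows "dyadic_index a l k' y = dyadic_index a l k' z"
  using assms by (simp add: fun_eq_iff dyadic_index_coarser[of l k k'])

lemma dyadic_cube_two_points:
  assumes "l > 0"
  shows "\<exists>y z. y \<noteq> z \<and> dyadic_index a l k y = m \<and> dyadic_index a l k z = m"
proof (intro exI conjI)
  let ?p = "\<lambda>t. a + (2 powi k * l) *\<^sub>R (\<chi> i. real_of_int (m i) + t)"
  have p: "dyadic_index a l k (?p t) = m" if "0 \<le> t" "t < 1" for t
    using assms that by (simp add: dyadic_index_def floor_eq_iff fun_eq_iff)
  show "dyadic_index a l k (?p 0) = m" "dyadic_index a l k (?p (1/2)) = m"
    by (rule p, simp, simp)+
  show "?p 0 \<noteq> ?p (1/2)"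
    using assms by (auto simp: vec_eq_iff)
qed

text \<open>A coarser cube has several children, namely those with index \<open>?m j\<close> for
  \<open>0 \<le> j < ?N\<close>. Were the index constant on the cube, the children for
  \<open>j = 0\<close> and \<open>j = 1\<close> would coincide.\<close>

lemma dyadic_cube_strictly_coarser:
  assumes "l > 0" "k < k'"
  shows "\<exists>z. dyadic_index a l k' z = dyadic_index a l k' y \<and> dyadic_index a l k z \<noteq> dyadic_index a l k y"
proof (rule ccontr)
  assume "\<not> ?thesis"
  then have eq: "dyadic_index a l k z = dyadic_index a l k y"
    if "dyadic_index a l k' z = dyadic_index a l k' y" for z
    using that by blast
  let ?N = "2 ^ nat (k' - k) :: int"
  have N: "?N \<ge> 2"
    using assms(2) power_increasing[of 1 "nat (k' - k)" "2::int"] by simp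
  let ?m = "\<lambda>j i. dyadic_index a l k' y i * ?N + j"
  have m: "?m j = dyadic_index a l k y" if "0 \<le> j" "j < ?N" for j
  proof -
    obtain z where z: "dyadic_index a l k z = ?m j" using dyadic_cube_two_points[OF assms(1)] by blast
    have "dyadic_index a l k' z = dyadic_index a l k' y"
      using assms z that N by (simp add: fun_eq_iff dyadic_index_coarser[of l k k'])
    from eq[OF this] z show ?thesis by simp
  qed
  have "?m 0 = dyadic_index a l k y" "?m 1 = dyadic_index a l k y"
    by (rule m; use N in simp)+
  then have "?m 0 = ?m 1" by (rule trans[OF _ sym])
  \<comment> \<open>Any coordinate separates the two indices; \<open>undefined\<close> merely names
    one.\<close>
  then have "?m 0 undefined = ?m 1 undefined" by (rule fun_cong)
  then show False by simp
qed

text \<open>Members of the dyadic system are bare sets. This recovers the order of their levels from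
  inclusion.\<close>

lemma dyadic_cube_level_le:
  assumes "l > 0" "{y. dyadic_index a l k y = m} \<subseteq> {y. dyadic_index a l k' y = m'}"
  shows "k \<le> k'"
proof (rule ccontr)
  assume "\<not> k \<le> k'"
  obtain y where y: "dyadic_index a l k y = m" using dyadic_cube_two_points[OF assms(1)] by blast
  obtain z where "dyadic_index a l k z = dyadic_index a l k y"
    "dyadic_index a l k' z \<noteq> dyadic_index a l k' y"
    using dyadic_cube_strictly_coarser[of l k' k] assms(1) \<open>\<not> k \<le> k'\<close> by fastforce
  then show False using y assms(2) by auto
qed

lemma dyadic_cubes0_nonempty:
  assumes "l > 0" "Q \<in> dyadic_cubes0 a l"
  shows "Q \<noteq> {}"
  using assms dyadic_cube_two_points[OF assms(1)] by (fastforce simp: dyadic_cubes0_eq)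

lemma dyadic_cubes0_nested:
  assumes "l > 0" "Q \<in> dyadic_cubes0 a l" "Q' \<in> dyadic_cubes0 a l" "Q \<inter> Q' \<noteq> {}"
  shows "Q \<subseteq> Q' \<or> Q' \<subseteq> Q"
proof -
  obtain k m k' m' where Q: "Q = {y. dyadic_index a l k y = m}" "Q' = {y. dyadic_index a l k' y = m'}"
    using assms by (auto simp: dyadic_cubes0_eq)
  obtain z where z: "dyadic_index a l k z = m" "dyadic_index a l k' z = m'"
    using assms(4) unfolding Q by blast
  show ?thesis
  proof (cases "k \<le> k'")
    case True
    from dyadic_index_eq_coarser[OF assms(1) this, of a _ z] show ?thesis
      unfolding Q using z by auto
  next
    case False
    then have "k' \<le> k" by simp
    from dyadic_index_eq_coarser[OF assms(1) this, of a _ z] show ?thesis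
      unfolding Q using z by auto
  qed
qed

text \<open>The faces of the orthants lie on grid hyperplanes of every level: the sign of an index
  coordinate decides on which side of \<open>a\<close> the point lies.\<close>

lemma dyadic_cube0_subset_orthant:
  assumes "l > 0" "Q \<in> dyadic_cubes0 a l" "H \<in> dyadic_orthants a" "Q \<inter> H \<noteq> {}"
  shows "Q \<subseteq> H"
proof -
  obtain k m where Q: "Q = {y. dyadic_index a l k y = m}"
    using assms by (auto simp: dyadic_cubes0_eq)
  obtain I where H: "H = {y. \<forall>i. y $ i \<in> I i}" "\<And>i. I i = {a $ i..} \<or> I i = {..<a $ i}"
    using assms(3) by (auto simp: dyadic_orthants_def)
  have "dyadic_index a l k y i \<ge> 0 \<longleftrightarrow> y $ i \<ge> a $ i" for y i
    unfolding dyadic_index_def using assms(1) by (simp add: pos_le_divide_eq)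
  then have "y $ i \<in> I i \<longleftrightarrow> z $ i \<in> I i" if "dyadic_index a l k y = dyadic_index a l k z" for y z i
    using H(2)[of i] that by (metis atLeast_iff lessThan_iff not_less)
  then show ?thesis using assms(4) unfolding Q H(1) by blast
qed

lemma dyadic_cubes_cases:
  assumes "l > 0" "Q \<in> dyadic_cubes0 a l" "Q' \<in> dyadic_cubes a l"
  obtains "Q \<inter> Q' = {}" | "Q \<subseteq> Q'" | "Q' \<in> dyadic_cubes0 a l" "Q' \<subseteq> Q"
proof -
  consider "Q' \<in> dyadic_cubes0 a l" | "Q' \<in> dyadic_orthants a"
    using assms(3) unfolding dyadic_cubes_def by blast
  then show thesis
    using that dyadic_cubes0_nested[OF assms(1,2), of Q'] dyadic_cube0_subset_orthant[OF assms(1,2), of Q']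
    by cases metis+
qed

lemma exists_dyadic_cube0:
  assumes "l > 0"
  shows "\<exists>Q\<in>dyadic_cubes0 a l. x \<in> Q"
proof
  let ?Q = "{y. dyadic_index a l 0 y = dyadic_index a l 0 x}"
  show "?Q \<in> dyadic_cubes0 a l"
    unfolding dyadic_cubes0_eq[OF assms] by (intro CollectI exI conjI) (rule refl, simp)
  show "x \<in> ?Q" by simp
qed

text \<open>Only finitely many levels lie between a cube and \<open>Q0\<close>, so maximal cubes exist.\<close>

lemma dyadic_cubes0_maximal:
  assumes "l > 0" "Q0 \<in> dyadic_cubes0 a l" "T \<subseteq> {Q \<in> dyadic_cubes0 a l. Q \<subseteq> Q0}" "Q \<in> T"
  shows "\<exists>Q'\<in>{Q \<in> T. \<forall>R\<in>T. Q \<subseteq> R \<longrightarrow> R = Q}. Q \<subseteq> Q'"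
proof -
  obtain k0 m0 where Q0: "Q0 = {y. dyadic_index a l k0 y = m0}"
    using assms by (auto simp: dyadic_cubes0_eq)
  let ?P = "\<lambda>j::nat. \<exists>m. {y. dyadic_index a l (k0 - int j) y = m} \<in> T \<and> Q \<subseteq> {y. dyadic_index a l (k0 - int j) y = m}"
  have ex: "\<exists>j m. R = {y. dyadic_index a l (k0 - int j) y = m}" if "R \<in> T" for R
  proof -
    have "R \<in> dyadic_cubes0 a l" "R \<subseteq> Q0" using assms(3) that by auto
    then obtain k m where R: "R = {y. dyadic_index a l k y = m}" "R \<subseteq> Q0"
      by (auto simp: dyadic_cubes0_eq[OF assms(1)])
    then have "k \<le> k0" using dyadic_cube_level_le[OF assms(1)] Q0 by blast
    then have "k = k0 - int (nat (k0 - k))" by simp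
    then show ?thesis using R by metis
  qed
  then have "\<exists>j. ?P j" using assms(4) by blast
  \<comment> \<open>Levels are counted downwards from \<open>k0\<close>, so the least
    \<open>j\<close> gives the coarsest member of \<open>T\<close> containing
    \<open>Q\<close>.\<close>
  define j where "j = (LEAST j. ?P j)"
  have "?P j" unfolding j_def using \<open>\<exists>j. ?P j\<close> by (rule LeastI_ex)
  then obtain m where m: "{y. dyadic_index a l (k0 - int j) y = m} \<in> T"
    "Q \<subseteq> {y. dyadic_index a l (k0 - int j) y = m}" by blast
  show ?thesis
  proof (rule bexI, rule m(2), intro CollectI conjI ballI impI)
    show "{y. dyadic_index a l (k0 - int j) y = m} \<in> T" by (rule m(1))
    fix R assume R: "R \<in> T" "{y. dyadic_index a l (k0 - int j) y = m} \<subseteq> R"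
    obtain j' m' where R': "R = {y. dyadic_index a l (k0 - int j') y = m'}" using ex R by blast
    have "?P j'" using R R' m by blast
    then have "j \<le> j'" unfolding j_def by (rule Least_le)
    moreover have "k0 - int j \<le> k0 - int j'"
      using dyadic_cube_level_le[OF assms(1)] R R' by blast
    ultimately have "j = j'" by simp
    obtain z where "dyadic_index a l (k0 - int j) z = m" using dyadic_cube_two_points[OF assms(1)] by blast
    then have "m = m'" using R R' \<open>j = j'\<close> by auto
    then show "R = {y. dyadic_index a l (k0 - int j) y = m}" using R' \<open>j = j'\<close> by simp
  qed
qed

lemma eventually_dyadic_tower_subset:
  assumes "l > 0" "Q0 \<in> dyadic_cubes0 a l" "x \<in> Q0"
  shows "\<forall>\<^sub>F Q in dyadic_tower a l x. Q \<in> dyadic_cubes0 a l \<and> x \<in> Q \<and> Q \<subseteq> Q0"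
proof -
  obtain k m where Q0: "Q0 = {y. dyadic_index a l k y = m}"
    using assms by (auto simp: dyadic_cubes0_eq)
  obtain z where z: "z \<in> Q0" "z \<noteq> x"
    using dyadic_cube_two_points[OF assms(1), of a k m] unfolding Q0 by blast
  show ?thesis
    unfolding eventually_dyadic_tower
  \<comment> \<open>The open ball of this radius misses \<open>z\<close>, so a cube inside it cannot
    contain \<open>Q0\<close>.\<close>
  proof (intro exI[of _ "dist x z"] conjI ballI impI)
    fix Q assume Q: "Q \<in> dyadic_cubes a l" "x \<in> Q \<and> Q \<subseteq> ball x (dist x z)"
    then have "\<not> Q0 \<subseteq> Q" "Q0 \<inter> Q \<noteq> {}" using z assms(3) by auto
    then show "Q \<in> dyadic_cubes0 a l" "x \<in> Q" "Q \<subseteq> Q0"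
      using dyadic_cubes_cases[OF assms(1,2) Q(1)] Q(2) by blast+
  qed (use z in auto)
qed

lemma eventually_dyadic_tower_ball:
  assumes "r > 0"
  shows "\<forall>\<^sub>F Q in dyadic_tower a l x. Q \<subseteq> ball x r"
  using assms unfolding eventually_dyadic_tower by blast

section \<open>The maximal function and Lebesgue points\<close>

context outer_capacity
begin

section \<open>Basic estimates for the Choquet integral\<close>

lemma choquet_borel_measurable [measurable]:
  "(\<lambda>t. C {x \<in> A. f x > ennreal t}) \<in> borel_measurable borel"
  by (intro antimono_borel_measurable_ennreal antimonoI mono) (auto intro: ennreal_leI le_less_trans)

lemma choquet_integral_mono_set:
  assumes "A \<subseteq> B"
  shows "choquet_integral C A f \<le> choquet_integral C B f"
  unfolding choquet_integral_def using assms by (intro nn_integral_mono mult_right_mono mono) auto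

lemma choquet_integral_null:
  assumes "C A = 0"
  shows "choquet_integral C A f = 0"
proof -
  have "C {x \<in> A. f x > ennreal t} = 0" for t
    using mono[of "{x \<in> A. f x > ennreal t}" A] assms by auto
  then show ?thesis by (simp add: choquet_integral_def)
qed

text \<open>For capacity 0 or infinity the average has the default value 0, so only the remaining
  case needs a division.\<close>

lemma choquet_average_le:
  assumes "choquet_integral C A f \<le> c * C A"
  shows "choquet_average C A f \<le> c"
proof (cases "C A = 0 \<or> C A = \<infinity>")
  case False
  then show ?thesis
    unfolding choquet_average_def using divide_right_mono_ennreal[OF assms, of "C A"]
    by (simp add: ennreal_mult_divide_eq)
qed (auto simp: choquet_average_def)

text \<open>Dominated convergence in the level variable \<open>t\<close>: for each \<open>t\<close>
  the integrand is at most \<open>C (U k)\<close>, which tends to 0.\<close>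

lemma choquet_integral_on_small_sets_tendsto_0:
  assumes fin: "choquet_integral C UNIV (\<lambda>x. ennreal \<bar>f x\<bar>) < \<infinity>"
    and U: "(\<lambda>k. C (U k)) \<longlonglongrightarrow> 0" "\<And>k. C (U k) \<le> 1" and "N \<ge> 0"
  shows "(\<lambda>k. choquet_integral C UNIV
    (\<lambda>y. if y \<in> U k then ennreal (2 * max N \<bar>f y\<bar>) else 0)) \<longlonglongrightarrow> 0"
proof -
  let ?g = "\<lambda>k y. if y \<in> U k then ennreal (2 * max N \<bar>f y\<bar>) else 0"
  let ?F = "\<lambda>t. C {x. ennreal \<bar>f x\<bar> > ennreal t}"
  \<comment> \<open>Up to \<open>2 * N\<close> the bound \<open>C (U k) \<le> 1\<close> dominates.
    Beyond it, \<open>2 * max N \<bar>f y\<bar> > t\<close> forces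
    \<open>\<bar>f y\<bar> > t / 2\<close>, and substituting \<open>t = 2 * u\<close> shows that
    this tail has finite integral.\<close>
  let ?w = "\<lambda>t. indicator {0..2 * N} t + ?F (t / 2) * indicator {0..} t"
  have F_meas [measurable]: "?F \<in> borel_measurable borel"
    using choquet_borel_measurable[of UNIV "\<lambda>x. ennreal \<bar>f x\<bar>"] by simp
  have [measurable]: "(\<lambda>t. ?F (t / 2)) \<in> borel_measurable borel"
    by (rule measurable_compose[OF _ F_meas]) simp
  have "(\<integral>\<^sup>+t. ?F (t / 2) * indicator {0..} t \<partial>lborel)
      = 2 * (\<integral>\<^sup>+t. ?F t * indicator {0..} t \<partial>lborel)"
    by (subst nn_integral_real_affine[where c = 2 and t = 0], measurable)
      (auto simp: zero_le_mult_iff indicator_def intro!: arg_cong2[where f = "(*)"] nn_integral_cong)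
  then have "(\<integral>\<^sup>+t. ?w t \<partial>lborel)
      = ennreal (2 * N) + 2 * choquet_integral C UNIV (\<lambda>x. ennreal \<bar>f x\<bar>)"
    using \<open>N \<ge> 0\<close> by (subst nn_integral_add) (auto simp: choquet_integral_def)
  also have "\<dots> < \<infinity>"
    using fin by (simp add: ennreal_mult_less_top)
  finally have w: "(\<integral>\<^sup>+t. ?w t \<partial>lborel) < \<infinity>" .
  have le_U: "C {x \<in> UNIV. ?g k x > ennreal t} * indicator {0..} t \<le> C (U k)" for k t
  proof -
    have "C {x \<in> UNIV. ?g k x > ennreal t} \<le> C (U k)"
      by (intro mono) (auto split: if_splits)
    moreover have "c * indicator {0..} t \<le> c" for c :: ennreal
      by (simp add: indicator_def)
    ultimately show ?thesis by (rule order_trans[rotated])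
  qed
  have le_w: "C {x \<in> UNIV. ?g k x > ennreal t} * indicator {0..} t \<le> ?w t" for k t
  proof (cases "0 \<le> t \<and> t \<le> 2 * N")
    case True
    have "C {x \<in> UNIV. ?g k x > ennreal t} * indicator {0..} t \<le> 1"
      using le_U U(2) order_trans by blast
    also have "\<dots> \<le> ?w t" using True by simp
    finally show ?thesis .
  next
    case False
    show ?thesis
    proof (cases "t \<ge> 0")
      case True
      then have "C {x \<in> UNIV. ?g k x > ennreal t} \<le> ?F (t / 2)"
        using False by (intro mono) (auto simp: ennreal_less_iff max_def split: if_splits)
      then have "C {x \<in> UNIV. ?g k x > ennreal t} * indicator {0..} t \<le> ?F (t / 2) * indicator {0..} t"
        by (rule mult_right_mono) simp
      also have "\<dots> \<le> ?w t" by simp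
      finally show ?thesis .
    qed simp
  qed
  have "(\<lambda>k. \<integral>\<^sup>+t. C {x \<in> UNIV. ?g k x > ennreal t} * indicator {0..} t \<partial>lborel)
      \<longlonglongrightarrow> (\<integral>\<^sup>+(t :: real). 0 \<partial>lborel)"
  proof (rule nn_integral_dominated_convergence[where w = ?w])
    fix k
    have [measurable]: "(\<lambda>t. C {x \<in> UNIV. ?g k x > ennreal t}) \<in> borel_measurable borel"
      by (rule choquet_borel_measurable)
    show "(\<lambda>t. C {x \<in> UNIV. ?g k x > ennreal t} * indicator {0..} t) \<in> borel_measurable lborel"
      by measurable
    show "AE t in lborel. C {x \<in> UNIV. ?g k x > ennreal t} * indicator {0..} t \<le> ?w t"
      by (intro AE_I2 le_w)
  next
    show "AE t in lborel. (\<lambda>k. C {x \<in> UNIV. ?g k x > ennreal t} * indicator {0..} t) \<longlonglongrightarrow> 0"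
      by (intro AE_I2 tendsto_sandwich[OF _ _ tendsto_const U(1)] always_eventually allI le_U) simp
  qed (use w in simp_all)
  then show ?thesis by (simp add: choquet_integral_def)
qed

end

section \<open>The weak type estimate under the packing assumption\<close>

locale packing_capacity = outer_capacity C
  for C :: "(real ^ 'n) set \<Rightarrow> ennreal" +
  fixes a :: "real ^ 'n" and l :: real and K :: ennreal
  assumes l: "l > 0"
    and K: "1 \<le> K" "K < \<infinity>"
    and packing: "\<And>F f. F \<subseteq> dyadic_cubes a l \<Longrightarrow> disjoint F \<Longrightarrow>
      (\<And>Q. Q \<in> dyadic_cubes a l \<Longrightarrow> infsum C {R \<in> F. R \<subseteq> Q} \<le> K * C Q) \<Longrightarrow>
      (\<Sum>\<^sub>\<infinity>R\<in>F. choquet_integral C R f) \<le> K * choquet_integral C (\<Union>F) f"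
begin

text \<open>Test sets reduce to subcubes of \<open>Q0\<close>: one disjoint from \<open>Q0\<close>
  contains no member of \<open>G\<close>, since cubes are nonempty, and one containing
  \<open>Q0\<close> contains the same members as \<open>Q0\<close> and has at least its
  capacity.\<close>

lemma packed_subcubes_integral:
  assumes Q0: "Q0 \<in> dyadic_cubes0 a l"
    and G: "G \<subseteq> {Q \<in> dyadic_cubes0 a l. Q \<subseteq> Q0}" "disjoint G"
      "packed {Q \<in> dyadic_cubes0 a l. Q \<subseteq> Q0} G"
  shows "(\<Sum>\<^sub>\<infinity>R\<in>G. choquet_integral C R f) \<le> K * choquet_integral C (\<Union>G) f"
proof (rule packing)
  show "G \<subseteq> dyadic_cubes a l" using G(1) by (auto simp: dyadic_cubes_def)
  show "disjoint G" by fact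
  fix Q assume Q: "Q \<in> dyadic_cubes a l"
  have "infsum C {R \<in> G. R \<subseteq> Q} \<le> C Q"
    using l Q0 Q
  proof (cases rule: dyadic_cubes_cases)
    case 1
    have "\<not> R \<subseteq> Q" if "R \<in> G" for R
    proof -
      have "R \<in> dyadic_cubes0 a l" "R \<subseteq> Q0" using that G(1) by auto
      then show ?thesis using 1 dyadic_cubes0_nonempty[OF l, of R a] by auto
    qed
    then have "{R \<in> G. R \<subseteq> Q} = {}" by simp
    then show ?thesis by (simp del: Collect_empty_eq)
  next
    case 2
    then have "{R \<in> G. R \<subseteq> Q} = {R \<in> G. R \<subseteq> Q0}" using G(1) by blast
    also have "infsum C \<dots> \<le> C Q0" using G(3) Q0 by (simp add: packed_def)
    also have "\<dots> \<le> C Q" using 2 by (rule mono)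
    finally show ?thesis .
  next
    case 3
    then show ?thesis using G(3) by (simp add: packed_def)
  qed
  also have "\<dots> \<le> K * C Q" using mult_right_mono[OF K(1), of "C Q"] by simp
  finally show "infsum C {R \<in> G. R \<subseteq> Q} \<le> K * C Q" .
qed

lemma maximal_function_weak_type:
  assumes Q0: "Q0 \<in> dyadic_cubes0 a l" and s: "0 < s" "s < \<infinity>"
  shows "C (\<Union>{Q \<in> dyadic_cubes0 a l. Q \<subseteq> Q0 \<and> s * C Q < choquet_integral C Q g})
    \<le> 3 * (K * choquet_integral C UNIV g / s)"
proof (cases "choquet_integral C UNIV g = \<infinity>")
  case True
  have "K * choquet_integral C UNIV g / s = \<infinity>"
    using True K s by (auto simp: ennreal_mult_top ennreal_top_divide)
  then show ?thesis by (simp add: ennreal_mult_top)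
next
  case False
  define I where "I = choquet_integral C UNIV g"
  have le_I: "choquet_integral C A g \<le> I" for A
    unfolding I_def by (rule choquet_integral_mono_set) simp
  let ?D = "{Q \<in> dyadic_cubes0 a l. Q \<subseteq> Q0}"
  define B where "B = {Q \<in> ?D. s * C Q < choquet_integral C Q g}"
  define F where "F = {Q \<in> B. \<forall>R\<in>B. Q \<subseteq> R \<longrightarrow> R = Q}"
  have disj: "disjoint {Q \<in> T. \<forall>R\<in>T. Q \<subseteq> R \<longrightarrow> R = Q}" if "T \<subseteq> ?D" for T
  proof (rule disjointI)
    fix Q R assume QR: "Q \<in> {Q \<in> T. \<forall>R\<in>T. Q \<subseteq> R \<longrightarrow> R = Q}"
      "R \<in> {Q \<in> T. \<forall>R\<in>T. Q \<subseteq> R \<longrightarrow> R = Q}" "Q \<noteq> R"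
    then have "Q \<in> dyadic_cubes0 a l" "R \<in> dyadic_cubes0 a l" "\<not> (Q \<subseteq> R \<or> R \<subseteq> Q)"
      using that by blast+
    then show "Q \<inter> R = {}" using dyadic_cubes0_nested[OF l] by blast
  qed
  have "B \<subseteq> ?D" by (auto simp: B_def)
  have F_D: "F \<subseteq> ?D" by (auto simp: B_def F_def)
  \<comment> \<open>These are the hypotheses of \<open>packed_selection\<close> with
    \<open>H = I / s\<close>. Positivity holds because a null cube has integral 0 and cannot satisfy
    the strict stopping inequality.\<close>
  have F_le: "C Q \<le> I / s" and F_pos: "0 < C Q" if "Q \<in> F" for Q
  proof -
    have lt: "s * C Q < choquet_integral C Q g" using that by (simp add: F_def B_def)
    show "0 < C Q" using lt choquet_integral_null[of Q g] by (cases "C Q = 0") (auto simp: zero_less_iff_neq_zero)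
    have "C Q * s \<le> I" using lt le_I[of Q] by (simp add: mult.commute)
    then have "C Q * s / s \<le> I / s" by (rule divide_right_mono_ennreal)
    then show "C Q \<le> I / s" using s by (simp add: ennreal_mult_divide_eq)
  qed
  have "I / s \<noteq> \<infinity>"
    using False s by (auto simp: I_def ennreal_divide_eq_top_iff)
  then have "I / s < \<infinity>" by (simp add: less_top)
  then obtain G where G: "G \<subseteq> F" "packed ?D G"
    and cover: "\<And>Q. Q \<in> F \<Longrightarrow> \<exists>Q'\<in>?D. Q \<subseteq> Q' \<and> C Q' \<le> 3 * infsum C {R \<in> G. R \<subseteq> Q'}"
    using packed_selection[OF F_D F_le _ F_pos] by blast
  have "disjoint F" unfolding F_def by (rule disj) fact
  then have "disjoint G" using G(1) by (rule pairwise_subset)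
  \<comment> \<open>Summing the stopping inequality over \<open>G\<close> bounds \<open>s\<close>
    times the selected mass by the sum of the integrals, to which packing applies.\<close>
  have "infsum C G \<le> K * I / s"
    unfolding infsum_le_iff_finite_sums_ennreal
  proof (intro allI impI)
    fix S assume S: "finite S \<and> S \<subseteq> G"
    have "sum C S * s \<le> (\<Sum>R\<in>S. choquet_integral C R g)"
      unfolding sum_distrib_right
      using S G(1) by (intro sum_mono) (auto simp: F_def B_def mult.commute intro: less_imp_le)
    also have "\<dots> \<le> (\<Sum>\<^sub>\<infinity>R\<in>G. choquet_integral C R g)"
      using S by (intro sum_le_infsum_ennreal) auto
    also have "\<dots> \<le> K * choquet_integral C (\<Union>G) g"
      using G F_D \<open>disjoint G\<close> by (intro packed_subcubes_integral[OF Q0]) auto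
    also have "\<dots> \<le> K * I" by (intro mult_left_mono le_I) simp
    finally have "sum C S * s / s \<le> K * I / s" by (rule divide_right_mono_ennreal)
    then show "sum C S \<le> K * I / s" using s by (simp add: ennreal_mult_divide_eq)
  qed
  \<comment> \<open>The cubes controlled by the selected mass inside them. Their maximal elements
    \<open>M\<close> cover the bad set and are disjoint, so each selected cube, being nonempty, is
    counted at most once.\<close>
  define T where "T = {Q \<in> ?D. C Q \<le> 3 * infsum C {R \<in> G. R \<subseteq> Q}}"
  define M where "M = {Q \<in> T. \<forall>R\<in>T. Q \<subseteq> R \<longrightarrow> R = Q}"
  have "T \<subseteq> ?D" by (auto simp: T_def)
  then have "disjoint M" unfolding M_def by (rule disj)
  have "Q \<subseteq> \<Union>M" if Q: "Q \<in> B" for Q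
  proof -
    obtain Q1 where Q1: "Q1 \<in> F" "Q \<subseteq> Q1"
      using dyadic_cubes0_maximal[OF l Q0 \<open>B \<subseteq> ?D\<close> Q] unfolding F_def by (elim bexE)
    then obtain Q2 where Q2: "Q2 \<in> T" "Q1 \<subseteq> Q2" using cover[of Q1] by (auto simp: T_def)
    obtain Q3 where "Q3 \<in> M" "Q2 \<subseteq> Q3"
      using dyadic_cubes0_maximal[OF l Q0 \<open>T \<subseteq> ?D\<close> Q2(1)] unfolding M_def by (elim bexE)
    with Q1(2) Q2(2) show ?thesis by blast
  qed
  then have "C (\<Union>B) \<le> C (\<Union>Q\<in>M. Q)" by (intro mono) auto
  also have "\<dots> \<le> 3 * infsum C G"
  proof (rule countable_Union_le)
    show "countable M"
      using \<open>T \<subseteq> ?D\<close> by (intro countable_subset[OF _ countable_dyadic_cubes0[of a l]]) (auto simp: M_def)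
    fix S assume S: "finite S" "S \<subseteq> M"
    have "(\<Sum>Q\<in>S. C Q) \<le> (\<Sum>Q\<in>S. 3 * infsum C {R \<in> G. R \<subseteq> Q})"
      using S by (intro sum_mono) (auto simp: M_def T_def)
    also have "\<dots> = 3 * (\<Sum>Q\<in>S. infsum C {R \<in> G. R \<subseteq> Q})"
      by (simp add: sum_distrib_left)
    also have "\<dots> \<le> 3 * infsum C G"
    proof (intro mult_left_mono sum_infsum_disjoint_le_ennreal S(1))
      have "R \<noteq> {}" if "R \<in> G" for R
        using that G(1) F_D dyadic_cubes0_nonempty[OF l] by blast
      then show "disjoint_family_on (\<lambda>Q. {R \<in> G. R \<subseteq> Q}) S"
        using \<open>disjoint M\<close> S(2) unfolding disjoint_family_on_def disjoint_def by blast
    qed auto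
    finally show "(\<Sum>Q\<in>S. C Q) \<le> 3 * infsum C G" .
  qed
  also have "\<dots> \<le> 3 * (K * I / s)"
    using \<open>infsum C G \<le> K * I / s\<close> by (intro mult_left_mono) simp_all
  finally show ?thesis by (simp add: B_def I_def conj_assoc)
qed

text \<open>One \<open>s\<close> comes from the levels \<open>t < s\<close>, where the capacity is
  at most \<open>C Q\<close>. The other comes from \<open>t \<ge> s\<close>, where only points of
  \<open>U\<close> remain and the stopping inequality fails for every small cube containing
  \<open>x\<close>.\<close>

lemma average_deviation_le:
  assumes f: "continuous_on (- U) f" and x: "x \<in> Q0" "x \<notin> U" "\<bar>f x\<bar> \<le> N"
    and Q0: "Q0 \<in> dyadic_cubes0 a l" and "s > 0"
    and max: "x \<notin> \<Union>{Q \<in> dyadic_cubes0 a l. Q \<subseteq> Q0 \<and> ennreal s * C Q <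
      choquet_integral C Q (\<lambda>y. if y \<in> U then ennreal (2 * max N \<bar>f y\<bar>) else 0)}"
  shows "\<forall>\<^sub>F Q in dyadic_tower a l x.
    choquet_average C Q (\<lambda>y. ennreal \<bar>f y - f x\<bar>) \<le> 2 * ennreal s"
proof -
  let ?g = "\<lambda>y. if y \<in> U then ennreal (2 * max N \<bar>f y\<bar>) else 0"
  let ?h = "\<lambda>y. ennreal \<bar>f y - f x\<bar>"
  obtain r where r: "r > 0" "\<And>y. y \<notin> U \<Longrightarrow> dist y x < r \<Longrightarrow> dist (f y) (f x) < s"
    using f x(2) \<open>s > 0\<close> unfolding continuous_on_iff by (metis ComplI)
  from eventually_dyadic_tower_subset[OF l Q0 x(1)] eventually_dyadic_tower_ball[OF r(1), of x a l]
  show ?thesis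
  proof eventually_elim
    case (elim Q)
    have "C {y \<in> Q. ?h y > ennreal t} * indicator {0..} t
        \<le> C Q * indicator {0..<s} t + C {y \<in> Q. ?g y > ennreal t} * indicator {0..} t" for t
    proof -
      consider "t < 0" | "0 \<le> t" "t < s" | "s \<le> t" by linarith
      then show ?thesis
      proof cases
        case 2
        have "C {y \<in> Q. ?h y > ennreal t} \<le> C Q" by (intro mono) auto
        then show ?thesis using 2 by (simp add: add_increasing2)
      next
        case 3
        have "C {y \<in> Q. ?h y > ennreal t} \<le> C {y \<in> Q. ?g y > ennreal t}"
        proof (intro mono subsetI)
          fix y assume y: "y \<in> {y \<in> Q. ?h y > ennreal t}"
          then have t: "\<bar>f y - f x\<bar> > t" using 3 \<open>s > 0\<close> by (simp add: ennreal_less_iff)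
          have "dist y x < r" using y elim by (auto simp: dist_commute)
          then have "y \<in> U" using r(2)[of y] t 3 by (force simp: dist_real_def)
          moreover have "2 * max N \<bar>f y\<bar> > t" using t x(3) by linarith
          ultimately show "y \<in> {y \<in> Q. ?g y > ennreal t}"
            using y 3 \<open>s > 0\<close> by (simp add: ennreal_less_iff)
        qed
        then show ?thesis by (simp add: add_increasing mult_right_mono)
      qed simp
    qed
    then have "choquet_integral C Q ?h \<le>
      (\<integral>\<^sup>+t. C Q * indicator {0..<s} t + C {y \<in> Q. ?g y > ennreal t} * indicator {0..} t \<partial>lborel)"
      unfolding choquet_integral_def by (intro nn_integral_mono) simp
    also have "\<dots> = C Q * ennreal s + choquet_integral C Q ?g"
      using \<open>s > 0\<close> by (subst nn_integral_add) (auto simp: choquet_integral_def nn_integral_cmult)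
    also have "choquet_integral C Q ?g \<le> ennreal s * C Q"
      using max elim by (auto simp: not_less)
    also have "C Q * ennreal s + ennreal s * C Q = 2 * ennreal s * C Q"
      unfolding mult_2 distrib_right by (simp add: mult.commute)
    finally show ?case by (simp add: choquet_average_le)
  qed
qed

text \<open>With \<open>s\<close> and \<open>N\<close> fixed, the exceptional set does not depend on
  \<open>k\<close>, yet it is covered by \<open>U k\<close> and the bad cubes for
  \<open>U k\<close>, whose capacities tend to 0.\<close>

lemma exceptional_set_null:
  assumes f: "f \<in> choquet_L1 C" and Q0: "Q0 \<in> dyadic_cubes0 a l" and "s > 0" "N \<ge> 0"
  shows "C {x \<in> Q0. \<bar>f x\<bar> \<le> N \<and> \<not> (\<forall>\<^sub>F Q in dyadic_tower a l x.
    choquet_average C Q (\<lambda>y. ennreal \<bar>f y - f x\<bar>) \<le> 2 * ennreal s)} = 0" (is "C ?B = 0")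
proof -
  have "\<exists>U. C U < ennreal (1 / Suc k) \<and> continuous_on (- U) f" for k
  proof -
    have "1 / Suc k > 0" by simp
    then show ?thesis using f unfolding choquet_L1_def quasicontinuous_def by blast
  qed
  then obtain U where U: "\<And>k. C (U k) < ennreal (1 / Suc k)" "\<And>k. continuous_on (- U k) f"
    by metis
  let ?g = "\<lambda>k y. if y \<in> U k then ennreal (2 * max N \<bar>f y\<bar>) else 0"
  have "(\<lambda>k. ennreal (1 / Suc k)) \<longlonglongrightarrow> ennreal 0"
    by (intro tendsto_ennrealI LIMSEQ_Suc[OF lim_1_over_n])
  then have lim: "(\<lambda>k. ennreal (1 / Suc k)) \<longlonglongrightarrow> 0" by simp
  have ev: "\<forall>\<^sub>F k in sequentially. C (U k) \<le> ennreal (1 / Suc k)"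
    by (rule always_eventually, rule allI, rule less_imp_le, rule U(1))
  have U0: "(\<lambda>k. C (U k)) \<longlonglongrightarrow> 0"
    by (rule tendsto_sandwich[OF _ ev tendsto_const lim]) simp
  have U1: "C (U k) \<le> 1" for k
  proof -
    have "ennreal (1 / Suc k) \<le> 1" by (simp add: ennreal_le_1)
    with U(1)[of k] show ?thesis by (rule less_imp_le[OF less_le_trans])
  qed
  have g0: "(\<lambda>k. choquet_integral C UNIV (?g k)) \<longlonglongrightarrow> 0"
    using f by (intro choquet_integral_on_small_sets_tendsto_0 U0 U1 \<open>N \<ge> 0\<close>) (simp add: choquet_L1_def)
  let ?c = "3 * (K / ennreal s)"
  have "C ?B \<le> C (U k) + ?c * choquet_integral C UNIV (?g k)" for k
  proof -
    let ?E = "\<Union>{Q \<in> dyadic_cubes0 a l. Q \<subseteq> Q0 \<and> ennreal s * C Q < choquet_integral C Q (?g k)}"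
    have "?B \<subseteq> U k \<union> ?E"
    proof
      fix x assume x: "x \<in> ?B"
      show "x \<in> U k \<union> ?E"
      proof (rule ccontr)
        assume "x \<notin> U k \<union> ?E"
        then have "x \<notin> U k \<and> x \<notin> ?E" unfolding Un_iff de_Morgan_disj .
        note U' = conjunct1[OF this] and E' = conjunct2[OF this]
        from x have B: "x \<in> Q0 \<and> \<bar>f x\<bar> \<le> N \<and> \<not> (\<forall>\<^sub>F Q in dyadic_tower a l x.
            choquet_average C Q (\<lambda>y. ennreal \<bar>f y - f x\<bar>) \<le> 2 * ennreal s)"
          by (rule CollectD)
        note x' = conjunct1[OF B] conjunct1[OF conjunct2[OF B]]
        from B have "\<not> (\<forall>\<^sub>F Q in dyadic_tower a l x.
            choquet_average C Q (\<lambda>y. ennreal \<bar>f y - f x\<bar>) \<le> 2 * ennreal s)"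
          by (elim conjE)
        then show False
          using average_deviation_le[OF U(2) x'(1) U' x'(2) Q0 \<open>s > 0\<close> E'] by (rule notE)
      qed
    qed
    then have "C ?B \<le> C (U k) + C ?E" by (meson mono order_trans subadd)
    also have "C ?E \<le> 3 * (K * choquet_integral C UNIV (?g k) / ennreal s)"
      using \<open>s > 0\<close> by (intro maximal_function_weak_type[OF Q0]) auto
    also have "\<dots> = ?c * choquet_integral C UNIV (?g k)"
      by (simp add: divide_ennreal_def ac_simps)
    finally show ?thesis by (simp add: add_left_mono)
  qed
  \<comment> \<open>Multiplication by \<open>?c\<close> is continuous at 0 because \<open>?c\<close>
    is finite.\<close>
  moreover have "K / ennreal s \<noteq> \<infinity>"
    using K \<open>s > 0\<close> by (auto simp: ennreal_divide_eq_top_iff)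
  then have "?c < top" by (simp add: ennreal_mult_less_top less_top)
  then have "(\<lambda>k. C (U k) + ?c * choquet_integral C UNIV (?g k)) \<longlonglongrightarrow> 0 + ?c * 0"
    by (intro tendsto_add U0 ennreal_tendsto_cmult g0)
  ultimately have "C ?B \<le> 0"
    by (intro LIMSEQ_le_const) auto
  then show ?thesis by simp
qed

text \<open>Countably many null sets suffice: countably many cubes \<open>Q0\<close> cover the
  space, naturals \<open>N\<close> bound \<open>\<bar>f x\<bar>\<close>, and the thresholds
  \<open>2 / Suc m\<close> fall below every positive \<open>c\<close>.\<close>

lemma lebesgue_points:
  assumes f: "f \<in> choquet_L1 C"
  shows "C {x. \<not> ((\<lambda>Q. choquet_average C Q (\<lambda>y. ennreal \<bar>f y - f x\<bar>)) \<longlongrightarrow> 0) (dyadic_tower a l x)} = 0"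
    (is "C ?E = 0")
proof -
  let ?good = "\<lambda>x s. \<forall>\<^sub>F Q in dyadic_tower a l x.
    choquet_average C Q (\<lambda>y. ennreal \<bar>f y - f x\<bar>) \<le> 2 * ennreal s"
  let ?B = "\<lambda>(Q0, N :: nat, m :: nat). {x \<in> Q0. \<bar>f x\<bar> \<le> real N \<and> \<not> ?good x (1 / Suc m)}"
  have "x \<in> (\<Union>p\<in>dyadic_cubes0 a l \<times> UNIV \<times> UNIV. ?B p)" if "x \<in> ?E" for x
  proof -
    have "\<exists>c>0. \<not> (\<forall>\<^sub>F Q in dyadic_tower a l x.
      choquet_average C Q (\<lambda>y. ennreal \<bar>f y - f x\<bar>) < c)"
    proof (rule ccontr)
      assume "\<not> ?thesis"
      then have *: "\<forall>\<^sub>F Q in dyadic_tower a l x.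
        choquet_average C Q (\<lambda>y. ennreal \<bar>f y - f x\<bar>) < c" if "c > 0" for c
        using that by blast
      have "((\<lambda>Q. choquet_average C Q (\<lambda>y. ennreal \<bar>f y - f x\<bar>)) \<longlongrightarrow> 0) (dyadic_tower a l x)"
        by (rule order_tendstoI) (simp, rule *)
      with that show False by simp
    qed
    then obtain c where c: "c > 0"
      "\<not> (\<forall>\<^sub>F Q in dyadic_tower a l x. choquet_average C Q (\<lambda>y. ennreal \<bar>f y - f x\<bar>) < c)"
      by blast
    have "(\<lambda>m. 2 * ennreal (1 / Suc m)) \<longlonglongrightarrow> 2 * ennreal 0"
      by (intro ennreal_tendsto_cmult tendsto_ennrealI LIMSEQ_Suc[OF lim_1_over_n]) simp
    then have "\<forall>\<^sub>F m in sequentially. 2 * ennreal (1 / Suc m) < c"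
      using c(1) by (intro order_tendstoD) auto
    then obtain m where m: "2 * ennreal (1 / Suc m) < c"
      by (auto simp: eventually_sequentially)
    have "\<not> ?good x (1 / Suc m)"
    proof
      assume "?good x (1 / Suc m)"
      then have "\<forall>\<^sub>F Q in dyadic_tower a l x.
        choquet_average C Q (\<lambda>y. ennreal \<bar>f y - f x\<bar>) < c"
        by (rule eventually_mono) (rule le_less_trans[OF _ m])
      with c(2) show False by contradiction
    qed
    moreover obtain N where "\<bar>f x\<bar> \<le> real N" using real_arch_simple by blast
    moreover obtain Q0 where "Q0 \<in> dyadic_cubes0 a l" "x \<in> Q0"
      using exists_dyadic_cube0[OF l] by blast
    ultimately show ?thesis by (intro UN_I[of "(Q0, N, m)"]) auto
  qed
  then have "C ?E \<le> C (\<Union>p\<in>dyadic_cubes0 a l \<times> UNIV \<times> UNIV. ?B p)"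
    by (intro mono subsetI)
  also have "\<dots> = 0"
    using exceptional_set_null[OF f]
    by (intro null_UN countable_SIGMA countable_dyadic_cubes0) auto
  finally show ?thesis by simp
qed

end

theorem theorem2:
  fixes C :: "(real ^ 'n) set \<Rightarrow> ennreal"
    and a :: "real ^ 'n" and l :: real
    and f :: "real ^ 'n \<Rightarrow> real"
  assumes "outer_measure_space (Pow UNIV) C"
    and "l > 0"
    and "packing_assumption C a l"
    and "f \<in> choquet_L1 C"
  shows "\<exists>E. C E = 0 \<and>
    (\<forall>x. x \<notin> E \<longrightarrow>
      ((\<lambda>Q'. choquet_average C Q' (\<lambda>y. ennreal \<bar>f y - f x\<bar>)) \<longlongrightarrow> 0) (dyadic_tower a l x))"
proof -
  obtain A0 :: real where A0: "A0 \<ge> 1" and packing: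
    "\<forall>F. F \<subseteq> dyadic_cubes a l \<and> disjoint F \<and>
      (\<forall>Q\<in>dyadic_cubes a l. infsum C {R \<in> F. R \<subseteq> Q} \<le> ennreal A0 * C Q) \<longrightarrow>
      (\<forall>f. (\<Sum>\<^sub>\<infinity>R\<in>F. choquet_integral C R f) \<le> ennreal A0 * choquet_integral C (\<Union>F) f)"
    using assms(3) unfolding packing_assumption_def by (elim exE conjE)
  interpret packing_capacity C a l "ennreal A0"
    using assms(1,2) A0 packing[rule_format] by unfold_locales (auto simp: ennreal_ge_1)
  show ?thesis using lebesgue_points[OF assms(4)] by blast
qed

end
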